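(* Let $A$ be a skew left brace and let $\Lambda_{A^{\mathrm{op}}}'$ be the commutator subgroup of the group $\Lambda_{A^{\mathrm{op}}}$. Then $\Lambda_{A^{\mathrm{op}}}'=A'\rtimes_{\lambda^{\mathrm{op}}}(A,\circ)'$, i.e. $\Lambda_{A^{\mathrm{op}}}'=\{(a,b)\mid a\in A',\ b\in (A,\circ)'\}$.
   Context: A skew left brace is a triple $(A,\cdot,\circ)$ where $(A,\cdot)$ and $(A,\circ)$ are groups with $a\circ(b\cdot c)=(a\circ b)\cdot a^{-1}\cdot(a\circ c)$ for all $a,b,c\in A$, where $a^{-1}$ is the inverse in $(A,\cdot)$. We write $ab=a\cdot b$; the two groups share the identity $1$. The map $\lambda:(A,\circ)\to\mathrm{Aut}(A,\cdot)$, $\lambda_a(b)=a^{-1}(a\circ b)$, is a group homomorphism, and so is $\lambda^{\mathrm{op}}:(A,\circ)\to\mathrm{Aut}(A,\cdot)$, $\lambda^{\mathrm{op}}_a(b)=(a\circ b)a^{-1}=a\lambda_a(b)a^{-1}$. The group $\Lambda_{A^{\mathrm{op}}}=(A,\cdot)\rtimes_{\lambda^{\mathrm{op}}}(A,\circ)$ is the set $A\times A$ with product $(a_1,b_1)(a_2,b_2)=(a_1\lambda^{\mathrm{op}}_{b_1}(a_2),\,b_1\circ b_2)$. $(A,\circ)'$ is the commutator subgroup of the group $(A,\circ)$. The commutator $A'$ of the skew left brace $A$ is the subgroup of $(A,\cdot)$ generated by all elements $aba^{-1}b^{-1}$ and $a\lambda_b(a^{-1})$ with $a,b\in A$; it is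 an ideal of $A$ (normal in both groups and stable under every $\lambda_a$). *)

theory Defs
  imports "HOL-Algebra.Generated_Groups"
begin

text \<open>A skew left brace $(A,\cdot,\circ)$ is given by two group records with the same carrier:
  \<open>G\<close> is $(A,\cdot)$ and \<open>C\<close> is $(A,\circ)$.\<close>

locale skew_left_brace = dot: group G + circ: group C
  for G :: "('a, 'm) monoid_scheme" and C :: "('a, 'n) monoid_scheme" +
  assumes carrier_eq: "carrier C = carrier G"
    and brace: "\<lbrakk>a \<in> carrier G; b \<in> carrier G; c \<in> carrier G\<rbrakk> \<Longrightarrow>
      a \<otimes>\<^bsub>C\<^esub> (b \<otimes>\<^bsub>G\<^esub> c) = (a \<otimes>\<^bsub>C\<^esub> b) \<otimes>\<^bsub>G\<^esub> inv\<^bsub>G\<^esub> a \<otimes>\<^bsub>G\<^esub> (a \<otimes>\<^bsub>C\<^esub> c)"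

definition brace_lambda :: "('a, 'm) monoid_scheme \<Rightarrow> ('a, 'n) monoid_scheme \<Rightarrow> 'a \<Rightarrow> 'a \<Rightarrow> 'a" where
  "brace_lambda G C a b = inv\<^bsub>G\<^esub> a \<otimes>\<^bsub>G\<^esub> (a \<otimes>\<^bsub>C\<^esub> b)"

definition brace_lambda_op :: "('a, 'm) monoid_scheme \<Rightarrow> ('a, 'n) monoid_scheme \<Rightarrow> 'a \<Rightarrow> 'a \<Rightarrow> 'a" where
  "brace_lambda_op G C a b = (a \<otimes>\<^bsub>C\<^esub> b) \<otimes>\<^bsub>G\<^esub> inv\<^bsub>G\<^esub> a"

text \<open>The semidirect product of \<open>N\<close> and \<open>H\<close> along \<open>\<phi>\<close>. It is a group when \<open>\<phi>\<close> is
  an action of \<open>H\<close> on \<open>N\<close> by automorphisms; only the values of \<open>\<phi>\<close> on the carriers matter.\<close>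

definition semidirect ::
  "('a, 'm) monoid_scheme \<Rightarrow> ('b, 'n) monoid_scheme \<Rightarrow> ('b \<Rightarrow> 'a \<Rightarrow> 'a) \<Rightarrow> ('a \<times> 'b) monoid" where
  "semidirect N H \<phi> =
    \<lparr>carrier = carrier N \<times> carrier H,
     mult = (\<lambda>(a1, b1) (a2, b2). (a1 \<otimes>\<^bsub>N\<^esub> \<phi> b1 a2, b1 \<otimes>\<^bsub>H\<^esub> b2)),
     one = (\<one>\<^bsub>N\<^esub>, \<one>\<^bsub>H\<^esub>)\<rparr>"

definition Lambda_op :: "('a, 'm) monoid_scheme \<Rightarrow> ('a, 'n) monoid_scheme \<Rightarrow> ('a \<times> 'a) monoid" where
  "Lambda_op G C = semidirect G C (brace_lambda_op G C)"

definition brace_commutator :: "('a, 'm) monoid_scheme \<Rightarrow> ('a, 'n) monoid_scheme \<Rightarrow> 'a set" where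
  "brace_commutator G C = generate G
    ({a \<otimes>\<^bsub>G\<^esub> b \<otimes>\<^bsub>G\<^esub> inv\<^bsub>G\<^esub> a \<otimes>\<^bsub>G\<^esub> inv\<^bsub>G\<^esub> b | a b. a \<in> carrier G \<and> b \<in> carrier G} \<union>
     {a \<otimes>\<^bsub>G\<^esub> brace_lambda G C b (inv\<^bsub>G\<^esub> a) | a b. a \<in> carrier G \<and> b \<in> carrier G})"

lemma group_semidirect:
  assumes "group N" "group H"
    and hom: "\<And>h. h \<in> carrier H \<Longrightarrow> \<phi> h \<in> hom N N"
    and one: "\<And>x. x \<in> carrier N \<Longrightarrow> \<phi> \<one>\<^bsub>H\<^esub> x = x"
    and mult: "\<And>h k x. \<lbrakk>h \<in> carrier H; k \<in> carrier H; x \<in> carrier N\<rbrakk> \<Longrightarrow>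
      \<phi> (h \<otimes>\<^bsub>H\<^esub> k) x = \<phi> h (\<phi> k x)"
  shows "group (semidirect N H \<phi>)"
proof -
  interpret N: group N by fact
  interpret H: group H by fact
  have cl: "\<phi> h x \<in> carrier N" if "h \<in> carrier H" "x \<in> carrier N" for h x
    using hom[OF that(1)] that(2) by (auto simp: hom_def)
  have mu: "\<phi> h (x \<otimes>\<^bsub>N\<^esub> y) = \<phi> h x \<otimes>\<^bsub>N\<^esub> \<phi> h y"
    if "h \<in> carrier H" "x \<in> carrier N" "y \<in> carrier N" for h x y
    using hom[OF that(1)] that(2,3) by (auto simp: hom_def)
  have un: "\<phi> h \<one>\<^bsub>N\<^esub> = \<one>\<^bsub>N\<^esub>" if "h \<in> carrier H" for h
    using hom_one[OF hom[OF that] \<open>group N\<close> \<open>group N\<close>] .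
  show ?thesis
  proof (rule groupI)
    fix p assume "p \<in> carrier (semidirect N H \<phi>)"
    then obtain a b where p: "p = (a, b)" and a: "a \<in> carrier N" and b: "b \<in> carrier H"
      by (auto simp: semidirect_def)
    have "\<phi> (inv\<^bsub>H\<^esub> b) (inv\<^bsub>N\<^esub> a) \<otimes>\<^bsub>N\<^esub> \<phi> (inv\<^bsub>H\<^esub> b) a = \<one>\<^bsub>N\<^esub>"
      using a b by (simp flip: mu add: un)
    then show "\<exists>q\<in>carrier (semidirect N H \<phi>). q \<otimes>\<^bsub>semidirect N H \<phi>\<^esub> p = \<one>\<^bsub>semidirect N H \<phi>\<^esub>"
      using a b by (intro bexI[of _ "(\<phi> (inv\<^bsub>H\<^esub> b) (inv\<^bsub>N\<^esub> a), inv\<^bsub>H\<^esub> b)"])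
        (auto simp: semidirect_def p cl)
  qed (auto simp: semidirect_def cl mu one mult N.m_assoc H.m_assoc)
qed

context skew_left_brace
begin

lemma one_eq: "\<one>\<^bsub>C\<^esub> = \<one>\<^bsub>G\<^esub>"
proof -
  have o: "\<one>\<^bsub>C\<^esub> \<in> carrier G"
    using circ.one_closed carrier_eq by simp
  then have "\<one>\<^bsub>C\<^esub> \<otimes>\<^bsub>C\<^esub> (\<one>\<^bsub>G\<^esub> \<otimes>\<^bsub>G\<^esub> \<one>\<^bsub>G\<^esub>) = inv\<^bsub>G\<^esub> \<one>\<^bsub>C\<^esub>"
    using brace[of "\<one>\<^bsub>C\<^esub>" "\<one>\<^bsub>G\<^esub>" "\<one>\<^bsub>G\<^esub>"] carrier_eq by simp
  then have "inv\<^bsub>G\<^esub> \<one>\<^bsub>C\<^esub> = \<one>\<^bsub>G\<^esub>"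
    using carrier_eq by simp
  then show ?thesis
    using o by (metis dot.inv_inv dot.inv_one)
qed

lemma circ_closed: "\<lbrakk>a \<in> carrier G; b \<in> carrier G\<rbrakk> \<Longrightarrow> a \<otimes>\<^bsub>C\<^esub> b \<in> carrier G"
  using circ.m_closed carrier_eq by simp

lemma group_Lambda_op: "group (Lambda_op G C)"
  unfolding Lambda_op_def
proof (rule group_semidirect)
  fix h assume "h \<in> carrier C"
  then have h: "h \<in> carrier G" by (simp add: carrier_eq)
  show "brace_lambda_op G C h \<in> hom G G"
    using h by (auto simp: hom_def brace_lambda_op_def brace circ_closed dot.m_assoc)
next
  fix x assume "x \<in> carrier G"
  then show "brace_lambda_op G C \<one>\<^bsub>C\<^esub> x = x"
    using circ.l_one[of x, unfolded one_eq carrier_eq] by (simp add: brace_lambda_op_def one_eq)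
next
  fix h k x assume "h \<in> carrier C" "k \<in> carrier C" and x: "x \<in> carrier G"
  then have h: "h \<in> carrier G" and k: "k \<in> carrier G" by (simp_all add: carrier_eq)
  have "h \<otimes>\<^bsub>C\<^esub> (inv\<^bsub>G\<^esub> k) = h \<otimes>\<^bsub>G\<^esub> inv\<^bsub>G\<^esub> (h \<otimes>\<^bsub>C\<^esub> k) \<otimes>\<^bsub>G\<^esub> h"
  proof -
    have "h = h \<otimes>\<^bsub>C\<^esub> (k \<otimes>\<^bsub>G\<^esub> inv\<^bsub>G\<^esub> k)"
      using h k carrier_eq one_eq circ.r_one[of h] by simp
    also have "\<dots> = (h \<otimes>\<^bsub>C\<^esub> k) \<otimes>\<^bsub>G\<^esub> inv\<^bsub>G\<^esub> h \<otimes>\<^bsub>G\<^esub> (h \<otimes>\<^bsub>C\<^esub> inv\<^bsub>G\<^esub> k)"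
      using h k by (intro brace) simp_all
    finally have e: "(h \<otimes>\<^bsub>C\<^esub> k) \<otimes>\<^bsub>G\<^esub> inv\<^bsub>G\<^esub> h \<otimes>\<^bsub>G\<^esub> (h \<otimes>\<^bsub>C\<^esub> inv\<^bsub>G\<^esub> k) = h" by simp
    have "h \<otimes>\<^bsub>C\<^esub> inv\<^bsub>G\<^esub> k = inv\<^bsub>G\<^esub> ((h \<otimes>\<^bsub>C\<^esub> k) \<otimes>\<^bsub>G\<^esub> inv\<^bsub>G\<^esub> h) \<otimes>\<^bsub>G\<^esub> h"
      using h k dot.inv_solve_left[of "h \<otimes>\<^bsub>C\<^esub> inv\<^bsub>G\<^esub> k" "(h \<otimes>\<^bsub>C\<^esub> k) \<otimes>\<^bsub>G\<^esub> inv\<^bsub>G\<^esub> h" h] e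
      by (simp add: circ_closed)
    then show ?thesis
      using h k by (simp add: dot.inv_mult_group circ_closed)
  qed
  moreover have "h \<otimes>\<^bsub>C\<^esub> k \<otimes>\<^bsub>C\<^esub> x = h \<otimes>\<^bsub>C\<^esub> (k \<otimes>\<^bsub>C\<^esub> x)"
    using h k x circ.m_assoc carrier_eq by simp
  moreover define u v where "u = h \<otimes>\<^bsub>C\<^esub> k" and "v = h \<otimes>\<^bsub>C\<^esub> (k \<otimes>\<^bsub>C\<^esub> x)"
  moreover have "u \<in> carrier G" "v \<in> carrier G"
    using h k x by (simp_all add: u_def v_def circ_closed)
  moreover have "inv\<^bsub>G\<^esub> h \<otimes>\<^bsub>G\<^esub> (h \<otimes>\<^bsub>G\<^esub> y) = y" if "y \<in> carrier G" for y
    using h that by (simp add: dot.m_assoc[symmetric])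
  ultimately show
    "brace_lambda_op G C (h \<otimes>\<^bsub>C\<^esub> k) x = brace_lambda_op G C h (brace_lambda_op G C k x)"
    using h k x by (simp add: brace_lambda_op_def brace circ_closed dot.m_assoc)
qed (rule dot.is_group circ.is_group)+

end

end

theory Submission
  imports Defs
begin

text \<open>For any semidirect product \<open>N \<rtimes> H\<close> let \<open>D\<close> be the subgroup of \<open>N\<close> generated by the
  commutators of \<open>N\<close> and the elements \<open>n \<phi>\<^sub>h(n\<^sup>-\<^sup>1)\<close>, which is the commutator of \<open>n\<close> and
  \<open>h\<close> in \<open>N \<rtimes> H\<close>. Modulo \<open>D\<close> the action becomes trivial and \<open>N\<close> becomes abelian, so
  \<open>(n, h) \<mapsto> D n\<close> is a homomorphism to an abelian group; together with the projection to \<open>H\<close>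
  this gives \<open>(N \<rtimes> H)' = D \<rtimes> H'\<close>. For the action \<open>\<lambda>\<^sup>o\<^sup>p\<close> of a skew left brace, \<open>D\<close> is the
  commutator of the brace, because \<open>\<lambda>\<^sup>o\<^sup>p\<^sub>b(x)\<close> and \<open>\<lambda>\<^sub>b(x)\<close> are conjugate.\<close>

text \<open>Let \<open>z\<close> be the conjugate by \<open>a\<close> of the commutator of
  \<open>b\<close> and \<open>y\<close>; then \<open>a (b y b^-1) = z (a y)\<close>. The derived
  subgroup is normal, so \<open>z\<close> lies in it and hence in \<open>S\<close>: the two products
  differ by a left factor from \<open>S\<close>.\<close>

lemma (in group) mult_conj_mem_iff:
  assumes S: "subgroup S G" and der: "derived G (carrier G) \<subseteq> S"
    and a: "a \<in> carrier G" and b: "b \<in> carrier G" and y: "y \<in> carrier G"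
  shows "a \<otimes> (b \<otimes> y \<otimes> inv b) \<in> S \<longleftrightarrow> a \<otimes> y \<in> S"
proof -
  interpret S: subgroup S G by fact
  define z where "z = a \<otimes> (b \<otimes> y \<otimes> inv b \<otimes> inv y) \<otimes> inv a"
  have "b \<otimes> y \<otimes> inv b \<otimes> inv y \<in> derived G (carrier G)"
    unfolding derived_def using b y by (intro generate.incl) blast
  then have z: "z \<in> S"
    unfolding z_def using der normal.inv_op_closed2[OF derived_self_is_normal] a by blast
  have "inv a \<otimes> (a \<otimes> y) = y"
    using a y by (simp add: m_assoc[symmetric])
  then have "a \<otimes> (b \<otimes> y \<otimes> inv b) = z \<otimes> (a \<otimes> y)"
    using a b y by (simp add: z_def m_assoc)
  moreover have "z \<otimes> (a \<otimes> y) \<in> S \<longleftrightarrow> a \<otimes> y \<in> S"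
  proof
    assume "z \<otimes> (a \<otimes> y) \<in> S"
    then have "inv z \<otimes> (z \<otimes> (a \<otimes> y)) \<in> S"
      using z by simp
    then show "a \<otimes> y \<in> S"
      using z a y by (simp add: m_assoc[symmetric])
  qed (use z in simp)
  ultimately show ?thesis by simp
qed

section \<open>The commutator subgroup of a general semidirect product\<close>

locale semidirect_product = N: group N + H: group H + L: group "semidirect N H \<phi>"
  for N :: "('a, 'm) monoid_scheme" and H :: "('b, 'n) monoid_scheme"
    and \<phi> :: "'b \<Rightarrow> 'a \<Rightarrow> 'a" +
  assumes action_hom: "h \<in> carrier H \<Longrightarrow> \<phi> h \<in> hom N N"
begin

abbreviation L where "L \<equiv> semidirect N H \<phi>"

text \<open>This is the \<open>D\<close> of the opening comment, shaped like
  \<open>brace_commutator\<close> with \<open>\<phi>\<close> in place of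
  \<open>brace_lambda\<close>. By \<open>derived_semidirect\<close> it is the kernel of the natural
  map from \<open>N\<close> to the abelianization of \<open>L\<close>.\<close>

definition commutator_kernel :: "'a set" where
  "commutator_kernel = generate N
    ({a \<otimes>\<^bsub>N\<^esub> b \<otimes>\<^bsub>N\<^esub> inv\<^bsub>N\<^esub> a \<otimes>\<^bsub>N\<^esub> inv\<^bsub>N\<^esub> b | a b. a \<in> carrier N \<and> b \<in> carrier N} \<union>
     {a \<otimes>\<^bsub>N\<^esub> \<phi> h (inv\<^bsub>N\<^esub> a) | a h. a \<in> carrier N \<and> h \<in> carrier H})"

lemma semidirect_simps:
  "carrier L = carrier N \<times> carrier H"
  "(a, b) \<otimes>\<^bsub>L\<^esub> (c, d) = (a \<otimes>\<^bsub>N\<^esub> \<phi> b c, b \<otimes>\<^bsub>H\<^esub> d)"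
  "\<one>\<^bsub>L\<^esub> = (\<one>\<^bsub>N\<^esub>, \<one>\<^bsub>H\<^esub>)"
  by (simp_all add: semidirect_def)

lemma action_group_hom: "h \<in> carrier H \<Longrightarrow> group_hom N N (\<phi> h)"
  using action_hom by (simp add: group_hom_def group_hom_axioms_def N.is_group)

lemma action_closed [simp]: "\<lbrakk>h \<in> carrier H; x \<in> carrier N\<rbrakk> \<Longrightarrow> \<phi> h x \<in> carrier N"
  using group_hom.hom_closed[OF action_group_hom] .

lemma action_one [simp]: "h \<in> carrier H \<Longrightarrow> \<phi> h \<one>\<^bsub>N\<^esub> = \<one>\<^bsub>N\<^esub>"
  using group_hom.hom_one[OF action_group_hom] .

text \<open>Triviality of the action of the identity is read off from the left unit law of the group
  \<open>L\<close>.\<close>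

lemma one_action [simp]: "x \<in> carrier N \<Longrightarrow> \<phi> \<one>\<^bsub>H\<^esub> x = x"
  using L.l_one[of "(x, \<one>\<^bsub>H\<^esub>)"] by (simp add: semidirect_simps)

lemma group_hom_fst_embedding: "group_hom N L (\<lambda>a. (a, \<one>\<^bsub>H\<^esub>))"
  by unfold_locales (auto simp: hom_def semidirect_simps)

lemma group_hom_snd_embedding: "group_hom H L (\<lambda>b. (\<one>\<^bsub>N\<^esub>, b))"
  by unfold_locales (auto simp: hom_def semidirect_simps)

lemma group_hom_snd: "group_hom L H snd"
  by unfold_locales (auto simp: hom_def semidirect_simps)

text \<open>Shows that the second family of generators of \<open>commutator_kernel\<close> comes
  from commutators of \<open>L\<close>. Inverses in \<open>L\<close> are computed by pulling them
  back along the two embeddings.\<close>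

lemma commutator_embeddings:
  assumes "a \<in> carrier N" "h \<in> carrier H"
  shows "(a, \<one>\<^bsub>H\<^esub>) \<otimes>\<^bsub>L\<^esub> (\<one>\<^bsub>N\<^esub>, h) \<otimes>\<^bsub>L\<^esub> inv\<^bsub>L\<^esub> (a, \<one>\<^bsub>H\<^esub>) \<otimes>\<^bsub>L\<^esub> inv\<^bsub>L\<^esub> (\<one>\<^bsub>N\<^esub>, h) =
    (a \<otimes>\<^bsub>N\<^esub> \<phi> h (inv\<^bsub>N\<^esub> a), \<one>\<^bsub>H\<^esub>)"
  using assms
  by (simp add: semidirect_simps
      flip: group_hom.hom_inv[OF group_hom_fst_embedding]
        group_hom.hom_inv[OF group_hom_snd_embedding])

lemma subgroup_commutator_kernel: "subgroup commutator_kernel N"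
  unfolding commutator_kernel_def by (rule N.generate_is_subgroup) auto

lemma derived_subset_commutator_kernel: "derived N (carrier N) \<subseteq> commutator_kernel"
  unfolding commutator_kernel_def derived_def by (rule N.mono_generate) blast

lemma commutator_kernel_mult_action:
  "\<lbrakk>a \<in> carrier N; h \<in> carrier H\<rbrakk> \<Longrightarrow> a \<otimes>\<^bsub>N\<^esub> \<phi> h (inv\<^bsub>N\<^esub> a) \<in> commutator_kernel"
  unfolding commutator_kernel_def by (intro generate.incl) blast

text \<open>Any subgroup containing the derived subgroup is normal: for \<open>a = 1\<close>,
  \<open>mult_conj_mem_iff\<close> says that membership is invariant under conjugation.\<close>

lemma normal_commutator_kernel: "commutator_kernel \<lhd> N"
  using N.mult_conj_mem_iff[OF subgroup_commutator_kernel derived_subset_commutator_kernel,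
      of "\<one>\<^bsub>N\<^esub>"] subgroup_commutator_kernel subgroup.mem_carrier[OF subgroup_commutator_kernel]
  by (simp add: N.normal_inv_iff)

text \<open>Since \<open>\<phi> h\<close> preserves inverses, the generator attached to
  \<open>x\<close> and \<open>h\<close> is \<open>x\<close> times the inverse of
  \<open>\<phi> h x\<close>.\<close>

lemma rcoset_action:
  assumes "h \<in> carrier H" "x \<in> carrier N"
  shows "commutator_kernel #>\<^bsub>N\<^esub> \<phi> h x = commutator_kernel #>\<^bsub>N\<^esub> x"
proof -
  interpret D: normal commutator_kernel N by (rule normal_commutator_kernel)
  have "x \<otimes>\<^bsub>N\<^esub> inv\<^bsub>N\<^esub> (\<phi> h x) \<in> commutator_kernel"
    using commutator_kernel_mult_action[of x h] assms
    by (simp add: group_hom.hom_inv[OF action_group_hom])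
  then have "commutator_kernel #>\<^bsub>N\<^esub> (x \<otimes>\<^bsub>N\<^esub> inv\<^bsub>N\<^esub> (\<phi> h x)) = commutator_kernel"
    using N.coset_join2 D.subgroup_axioms by auto
  then show ?thesis
    using assms N.coset_mult_inv1[of commutator_kernel x "\<phi> h x"] D.subset by simp
qed

text \<open>The commutator of \<open>x\<close> and \<open>y\<close> equals
  \<open>(x y) (y x)^-1\<close>, so its membership in the kernel identifies the cosets of
  \<open>x y\<close> and \<open>y x\<close>.\<close>

lemma comm_group_commutator_kernel_quotient: "comm_group (N Mod commutator_kernel)"
proof -
  interpret D: normal commutator_kernel N by (rule normal_commutator_kernel)
  interpret Q: group "N Mod commutator_kernel" by (rule D.factorgroup_is_group)
  show ?thesis
  proof (rule Q.group_comm_groupI)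
    fix X Y
    assume "X \<in> carrier (N Mod commutator_kernel)" "Y \<in> carrier (N Mod commutator_kernel)"
    then obtain x y where xy: "x \<in> carrier N" "y \<in> carrier N"
      "X = commutator_kernel #>\<^bsub>N\<^esub> x" "Y = commutator_kernel #>\<^bsub>N\<^esub> y"
      by (auto simp: carrier_FactGroup)
    have "x \<otimes>\<^bsub>N\<^esub> y \<otimes>\<^bsub>N\<^esub> inv\<^bsub>N\<^esub> x \<otimes>\<^bsub>N\<^esub> inv\<^bsub>N\<^esub> y \<in> commutator_kernel"
      unfolding commutator_kernel_def using xy by (intro generate.incl) blast
    moreover have "x \<otimes>\<^bsub>N\<^esub> y \<otimes>\<^bsub>N\<^esub> inv\<^bsub>N\<^esub> x \<otimes>\<^bsub>N\<^esub> inv\<^bsub>N\<^esub> y = (x \<otimes>\<^bsub>N\<^esub> y) \<otimes>\<^bsub>N\<^esub> inv\<^bsub>N\<^esub> (y \<otimes>\<^bsub>N\<^esub> x)"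
      using xy by (simp add: N.inv_mult_group N.m_assoc)
    ultimately have "commutator_kernel #>\<^bsub>N\<^esub> ((x \<otimes>\<^bsub>N\<^esub> y) \<otimes>\<^bsub>N\<^esub> inv\<^bsub>N\<^esub> (y \<otimes>\<^bsub>N\<^esub> x)) = commutator_kernel"
      using N.coset_join2 D.subgroup_axioms by auto
    then have "commutator_kernel #>\<^bsub>N\<^esub> (x \<otimes>\<^bsub>N\<^esub> y) = commutator_kernel #>\<^bsub>N\<^esub> (y \<otimes>\<^bsub>N\<^esub> x)"
      using xy D.subset by (intro N.coset_mult_inv1) simp_all
    then show "X \<otimes>\<^bsub>N Mod commutator_kernel\<^esub> Y = Y \<otimes>\<^bsub>N Mod commutator_kernel\<^esub> X"
      using xy by (simp add: D.rcos_sum)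
  qed
qed

text \<open>The product of \<open>L\<close> twists the second factor by \<open>\<phi>\<close>, and
  \<open>rcoset_action\<close> makes this twist invisible on cosets.\<close>

lemma group_hom_quotient:
  "group_hom L (N Mod commutator_kernel) (\<lambda>(a, b). commutator_kernel #>\<^bsub>N\<^esub> a)"
proof -
  interpret D: normal commutator_kernel N by (rule normal_commutator_kernel)
  interpret Q: group "N Mod commutator_kernel" by (rule D.factorgroup_is_group)
  show ?thesis
    by unfold_locales
      (auto simp: hom_def semidirect_simps carrier_FactGroup rcoset_action simp flip: D.rcos_sum)
qed

theorem derived_semidirect:
  "derived L (carrier L) = commutator_kernel \<times> derived H (carrier H)"
proof
  show "derived L (carrier L) \<subseteq> commutator_kernel \<times> derived H (carrier H)"
  proof
    fix p assume p: "p \<in> derived L (carrier L)"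
    obtain a b where ab: "p = (a, b)" by (cases p)
    have a: "a \<in> carrier N"
      using p L.derived_in_carrier[of "carrier L"] by (auto simp: ab semidirect_simps)
    interpret q: group_hom L "N Mod commutator_kernel" "\<lambda>(a, b). commutator_kernel #>\<^bsub>N\<^esub> a"
      by (rule group_hom_quotient)
    have "commutator_kernel #>\<^bsub>N\<^esub> a \<in>
        (\<lambda>(a, b). commutator_kernel #>\<^bsub>N\<^esub> a) ` derived L (carrier L)"
      using p by (force simp: ab)
    also have "\<dots> = derived (N Mod commutator_kernel)
        ((\<lambda>(a, b). commutator_kernel #>\<^bsub>N\<^esub> a) ` carrier L)"
      by (simp add: q.derived_img)
    \<comment> \<open>The derived subgroup of a subset of an abelian group is trivial, and the
      identity of the quotient is the coset \<open>commutator_kernel\<close> itself.\<close>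
    also have "\<dots> = {commutator_kernel}"
      using comm_group.derived_eq_singleton[OF comm_group_commutator_kernel_quotient
          image_subsetI[OF q.hom_closed]] by simp
    finally have "a \<in> commutator_kernel"
      using N.coset_join1[OF _ a subgroup_commutator_kernel] by simp
    moreover have "snd p \<in> derived H (snd ` carrier L)"
      using p by (subst group_hom.derived_img[OF group_hom_snd subset_refl]) (rule imageI)
    then have "b \<in> derived H (carrier H)"
      using H.mono_derived[OF image_subsetI, of "carrier L" snd "carrier H"]
        group_hom.hom_closed[OF group_hom_snd] by (auto simp: ab)
    ultimately show "p \<in> commutator_kernel \<times> derived H (carrier H)" by (simp add: ab)
  qed
next
  interpret i: group_hom N L "\<lambda>a. (a, \<one>\<^bsub>H\<^esub>)" by (rule group_hom_fst_embedding)
  interpret j: group_hom H L "\<lambda>b. (\<one>\<^bsub>N\<^esub>, b)" by (rule group_hom_snd_embedding)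
  interpret D: subgroup "derived L (carrier L)" L by (rule L.derived_is_subgroup) simp
  have comm: "p \<otimes>\<^bsub>L\<^esub> q \<otimes>\<^bsub>L\<^esub> inv\<^bsub>L\<^esub> p \<otimes>\<^bsub>L\<^esub> inv\<^bsub>L\<^esub> q \<in> derived L (carrier L)"
    if "p \<in> carrier L" "q \<in> carrier L" for p q
    unfolding derived_def using that by (intro generate.incl) blast
  show "commutator_kernel \<times> derived H (carrier H) \<subseteq> derived L (carrier L)"
  proof clarify
    fix a b assume a: "a \<in> commutator_kernel" and b: "b \<in> derived H (carrier H)"
    \<comment> \<open>The image of a generated subgroup is generated by the images of the
      generators, so it suffices to see that each generator becomes a commutator of
      \<open>L\<close>.\<close>
    have "(\<lambda>a. (a, \<one>\<^bsub>H\<^esub>)) ` commutator_kernel \<subseteq> derived L (carrier L)"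
      unfolding commutator_kernel_def
    proof (subst i.generate_img[symmetric])
      show "generate L ((\<lambda>a. (a, \<one>\<^bsub>H\<^esub>)) `
        ({a \<otimes>\<^bsub>N\<^esub> b \<otimes>\<^bsub>N\<^esub> inv\<^bsub>N\<^esub> a \<otimes>\<^bsub>N\<^esub> inv\<^bsub>N\<^esub> b | a b. a \<in> carrier N \<and> b \<in> carrier N} \<union>
         {a \<otimes>\<^bsub>N\<^esub> \<phi> h (inv\<^bsub>N\<^esub> a) | a h. a \<in> carrier N \<and> h \<in> carrier H})) \<subseteq> derived L (carrier L)"
      proof (rule L.generate_subgroup_incl[OF _ D.subgroup_axioms], rule image_subsetI, elim UnE; clarify)
        fix a b assume "a \<in> carrier N" "b \<in> carrier N"
        then show "(a \<otimes>\<^bsub>N\<^esub> b \<otimes>\<^bsub>N\<^esub> inv\<^bsub>N\<^esub> a \<otimes>\<^bsub>N\<^esub> inv\<^bsub>N\<^esub> b, \<one>\<^bsub>H\<^esub>) \<in> derived L (carrier L)"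
          using comm[OF i.hom_closed i.hom_closed] by (simp flip: i.hom_inv i.hom_mult)
      next
        fix a h assume "a \<in> carrier N" "h \<in> carrier H"
        then show "(a \<otimes>\<^bsub>N\<^esub> \<phi> h (inv\<^bsub>N\<^esub> a), \<one>\<^bsub>H\<^esub>) \<in> derived L (carrier L)"
          using comm[OF i.hom_closed j.hom_closed] commutator_embeddings by simp
      qed
    qed auto
    moreover have "(\<lambda>b. (\<one>\<^bsub>N\<^esub>, b)) ` derived H (carrier H) \<subseteq> derived L (carrier L)"
      using L.mono_derived[OF image_subsetI, of "carrier H" "\<lambda>b. (\<one>\<^bsub>N\<^esub>, b)" "carrier L"]
        j.hom_closed j.derived_img[OF subset_refl] by simp
    \<comment> \<open>Every pair factors as \<open>(a, b) = (a, 1) (1, b)\<close>, so the two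
      embedded subgroups together give the whole product set.\<close>
    ultimately have "(a, \<one>\<^bsub>H\<^esub>) \<otimes>\<^bsub>L\<^esub> (\<one>\<^bsub>N\<^esub>, b) \<in> derived L (carrier L)"
      using a b by (intro D.m_closed) auto
    moreover have "a \<in> carrier N" "b \<in> carrier H"
      using a b subgroup.subset[OF subgroup_commutator_kernel] H.derived_in_carrier by auto
    ultimately show "(a, b) \<in> derived L (carrier L)"
      by (simp add: semidirect_simps)
  qed
qed

end

section \<open>The action \<open>brace_lambda_op\<close> of a skew left brace\<close>

context skew_left_brace
begin

lemma brace_lambda_closed:
  "\<lbrakk>a \<in> carrier G; b \<in> carrier G\<rbrakk> \<Longrightarrow> brace_lambda G C a b \<in> carrier G"
  by (simp add: brace_lambda_def circ_closed)

lemma brace_lambda_op_conj: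
  "\<lbrakk>a \<in> carrier G; b \<in> carrier G\<rbrakk> \<Longrightarrow>
    brace_lambda_op G C a b = a \<otimes>\<^bsub>G\<^esub> brace_lambda G C a b \<otimes>\<^bsub>G\<^esub> inv\<^bsub>G\<^esub> a"
  by (simp add: brace_lambda_op_def brace_lambda_def circ_closed flip: dot.m_assoc)

text \<open>Multiplying the brace axiom on the right by the inverse of \<open>a\<close> in
  \<open>G\<close> says exactly that \<open>brace_lambda_op G C a\<close> is multiplicative.\<close>

lemma semidirect_product_Lambda_op: "semidirect_product G C (brace_lambda_op G C)"
proof -
  interpret L: group "semidirect G C (brace_lambda_op G C)"
    using group_Lambda_op by (simp add: Lambda_op_def)
  show ?thesis
    by unfold_locales
      (auto simp: hom_def brace_lambda_op_def brace circ_closed carrier_eq dot.m_assoc)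
qed

lemma commutator_kernel_Lambda_op:
  "semidirect_product.commutator_kernel G C (brace_lambda_op G C) = brace_commutator G C"
proof -
  interpret semidirect_product G C "brace_lambda_op G C"
    by (rule semidirect_product_Lambda_op)
  let ?K = "{a \<otimes>\<^bsub>G\<^esub> b \<otimes>\<^bsub>G\<^esub> inv\<^bsub>G\<^esub> a \<otimes>\<^bsub>G\<^esub> inv\<^bsub>G\<^esub> b | a b. a \<in> carrier G \<and> b \<in> carrier G}"
  have B: "subgroup (brace_commutator G C) G"
    unfolding brace_commutator_def
    by (rule dot.generate_is_subgroup) (auto simp: brace_lambda_closed)
  have derB: "derived G (carrier G) \<subseteq> brace_commutator G C"
    unfolding brace_commutator_def derived_def by (rule dot.mono_generate) blast
  have derK: "?K \<subseteq> derived G (carrier G)"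
    unfolding derived_def by (blast intro: generate.incl)
  \<comment> \<open>This is \<open>mult_conj_mem_iff\<close> with
    \<open>y = brace_lambda G C b (inv a)\<close>. It is stated for all \<open>S\<close> because
    each inclusion below takes a different one of the two subgroups as \<open>S\<close>.\<close>
  have conj: "a \<otimes>\<^bsub>G\<^esub> brace_lambda_op G C b (inv\<^bsub>G\<^esub> a) \<in> S \<longleftrightarrow>
      a \<otimes>\<^bsub>G\<^esub> brace_lambda G C b (inv\<^bsub>G\<^esub> a) \<in> S"
    if "subgroup S G" "derived G (carrier G) \<subseteq> S" "a \<in> carrier G" "b \<in> carrier G" for S a b
    using dot.mult_conj_mem_iff[OF that(1,2)] that(3,4)
    by (simp add: brace_lambda_op_conj brace_lambda_closed)
  have lamB: "a \<otimes>\<^bsub>G\<^esub> brace_lambda G C b (inv\<^bsub>G\<^esub> a) \<in> brace_commutator G C"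
    if "a \<in> carrier G" "b \<in> carrier G" for a b
    unfolding brace_commutator_def using that by (intro generate.incl) blast
  show ?thesis
  proof
    show "commutator_kernel \<subseteq> brace_commutator G C"
      unfolding commutator_kernel_def
      using derK derB lamB conj[OF B derB]
      by (intro dot.generate_subgroup_incl[OF _ B]) (auto simp: carrier_eq)
    show "brace_commutator G C \<subseteq> commutator_kernel"
      unfolding brace_commutator_def
      using derK derived_subset_commutator_kernel commutator_kernel_mult_action
        conj[OF subgroup_commutator_kernel derived_subset_commutator_kernel]
      by (intro dot.generate_subgroup_incl[OF _ subgroup_commutator_kernel])
        (auto simp: carrier_eq)
  qed
qed

end

theorem theorem3p7:
  fixes G :: "('a, 'm) monoid_scheme" and C :: "('a, 'n) monoid_scheme"
  assumes "skew_left_brace G C"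
  shows "(Lambda_op G C)\<lparr>carrier := derived (Lambda_op G C) (carrier (Lambda_op G C))\<rparr> =
           semidirect (G\<lparr>carrier := brace_commutator G C\<rparr>)
             (C\<lparr>carrier := derived C (carrier C)\<rparr>) (brace_lambda_op G C) \<and>
         derived (Lambda_op G C) (carrier (Lambda_op G C)) =
           {(a, b) | a b. a \<in> brace_commutator G C \<and> b \<in> derived C (carrier C)}"
proof -
  interpret skew_left_brace G C by fact
  have "derived (Lambda_op G C) (carrier (Lambda_op G C)) =
      brace_commutator G C \<times> derived C (carrier C)"
    using semidirect_product.derived_semidirect[OF semidirect_product_Lambda_op]
    by (simp add: Lambda_op_def commutator_kernel_Lambda_op)
  \<comment> \<open>Replacing a carrier leaves product and unit unchanged, so the equality of
    records reduces to that of the carriers.\<close>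
  then show ?thesis
    by (auto simp: Lambda_op_def semidirect_def)
qed

end
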